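(* The point $P$ ($\neq A, B, C$) lies on the Steiner circumellipse $\iota(l_\infty)$ of $ABC$ if and only if $T_P\circ T_{P'} = K^{-1}$.
   Context: The plane is the real Euclidean plane extended by the line at infinity $l_\infty$; points not on $l_\infty$ are ordinary, points on it are infinite. $XY$ denotes the line through $X,Y$, and $\ell\cdot m$ the intersection of lines $\ell,m$. $ABC$ is a nondegenerate triangle with ordinary vertices, its sides being full lines; $G$ is its centroid. The complement map $K$ is the affine map fixing $G$ and sending each ordinary $Y$ to the point $K(Y)$ with $\overrightarrow{GK(Y)}=-\tfrac12\overrightarrow{GY}$; it fixes every infinite point. The anticomplementary triangle is $K^{-1}(ABC)$. $P$ is a point (ordinary or infinite) not lying on the extended sides of $ABC$ or of its anticomplementary triangle. The cevian triangle $DEF$ of $P$ is given by $D=AP\cdot BC$, $E=BP\cdot AC$, $F=CP\cdot AB$. Let $D_3,E_3,F_3$ be the reflections of $D,E,F$ in the midpoints of $BC,AC,AB$ respectively; the lines $AD_3,BE_3,CF_3$ meet in the isotomic conjugate $P'=\iota(P)$ (possibly infinite), so $D_3E_3F_3$ is the cevian triangle of $P'$. $T_P$ and $T_{P'}$ are the affine maps taking $A,B,C$ to $D,E,F$ and to $D_3,E_3,F_3$ respectively. The Steiner circumellipse of $ABC$ (which contains $A,B,C$) is the set $\iota(l_\infty)$; a point $P$ not lying on the extended sides of $ABC$ or of its anticomplementary triangle lies on it exactly when $\iota(P)$ is infinite. *)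

theory Defs
  imports "HOL-Analysis.Analysis"
begin

section \<open>The Euclidean plane extended by its line at infinity\<close>

typedef direction = "{S :: (real^2) set. subspace S \<and> dim S = 1}"
proof -
  have "dim (span {axis 1 1 :: real^2}) = 1"
    by (simp add: dim_span dim_singleton)
  then show ?thesis
    using subspace_span by blast
qed

text \<open>An infinite point is a direction, i.e. a class of parallel lines.\<close>

datatype ext_point = Ordinary "real^2" | Infinite direction

definition ordinary_line :: "real^2 \<Rightarrow> direction \<Rightarrow> ext_point set" where
  "ordinary_line p d = insert (Infinite d) (Ordinary ` {p + v | v. v \<in> Rep_direction d})"

definition line_at_infinity :: "ext_point set" where
  "line_at_infinity = range Infinite"

definition ext_lines :: "ext_point set set" where
  "ext_lines = insert line_at_infinity {ordinary_line p d | p d. True}"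

definition line_through :: "ext_point \<Rightarrow> ext_point \<Rightarrow> ext_point set" where
  "line_through X Y = (THE l. l \<in> ext_lines \<and> X \<in> l \<and> Y \<in> l)"

definition meet_point :: "ext_point set \<Rightarrow> ext_point set \<Rightarrow> ext_point" where
  "meet_point l m = (THE X. X \<in> l \<and> X \<in> m)"


section \<open>Affine maps of the extended plane\<close>

text \<open>
  Affine maps act on the whole extended plane, so they are taken to be nonsingular: only an
  injective linear part sends every direction to a direction.
\<close>

fun ext_affine :: "(real^2 \<Rightarrow> real^2) \<Rightarrow> real^2 \<Rightarrow> ext_point \<Rightarrow> ext_point" where
  "ext_affine g c (Ordinary x) = Ordinary (g x + c)"
| "ext_affine g c (Infinite d) = Infinite (Abs_direction (g ` Rep_direction d))"

definition affine_map :: "(ext_point \<Rightarrow> ext_point) \<Rightarrow> bool" where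
  "affine_map f \<longleftrightarrow> (\<exists>g c. linear g \<and> inj g \<and> f = ext_affine g c)"

definition triangle_map ::
    "real^2 \<Rightarrow> real^2 \<Rightarrow> real^2 \<Rightarrow> ext_point \<Rightarrow> ext_point \<Rightarrow> ext_point \<Rightarrow> ext_point \<Rightarrow> ext_point" where
  "triangle_map A B C X Y Z =
     (THE f. affine_map f \<and> f (Ordinary A) = X \<and> f (Ordinary B) = Y \<and> f (Ordinary C) = Z)"

fun point_reflection :: "real^2 \<Rightarrow> ext_point \<Rightarrow> ext_point" where
  "point_reflection M (Ordinary Y) = Ordinary (M - (Y - M))"
| "point_reflection M (Infinite d) = Infinite d"


section \<open>Triangle geometry\<close>

definition centroid :: "real^2 \<Rightarrow> real^2 \<Rightarrow> real^2 \<Rightarrow> real^2" where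
  "centroid A B C = (1/3) *\<^sub>R (A + B + C)"

fun complement_map :: "real^2 \<Rightarrow> real^2 \<Rightarrow> real^2 \<Rightarrow> ext_point \<Rightarrow> ext_point" where
  "complement_map A B C (Ordinary Y) =
     Ordinary (centroid A B C - (1/2) *\<^sub>R (Y - centroid A B C))"
| "complement_map A B C (Infinite d) = Infinite d"

definition on_sides :: "ext_point \<Rightarrow> ext_point \<Rightarrow> ext_point \<Rightarrow> ext_point \<Rightarrow> bool" where
  "on_sides X Y Z P \<longleftrightarrow>
     P \<in> line_through Y Z \<or> P \<in> line_through X Z \<or> P \<in> line_through X Y"

definition on_triangle_sides :: "real^2 \<Rightarrow> real^2 \<Rightarrow> real^2 \<Rightarrow> ext_point \<Rightarrow> bool" where
  "on_triangle_sides A B C = on_sides (Ordinary A) (Ordinary B) (Ordinary C)"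

definition on_anticomplementary_sides :: "real^2 \<Rightarrow> real^2 \<Rightarrow> real^2 \<Rightarrow> ext_point \<Rightarrow> bool" where
  "on_anticomplementary_sides A B C =
     on_sides (inv (complement_map A B C) (Ordinary A))
              (inv (complement_map A B C) (Ordinary B))
              (inv (complement_map A B C) (Ordinary C))"

text \<open>
  \<open>cevian_trace U V W P\<close> is the point \<open>UP \<cdot> VW\<close> and \<open>isotomic_trace U V W P\<close> its reflection in
  the midpoint of \<open>VW\<close>. Both are symmetric in \<open>V\<close> and \<open>W\<close>, so for a triangle \<open>ABC\<close> one gets
  \<open>D, E, F\<close> and \<open>D\<^sub>3, E\<^sub>3, F\<^sub>3\<close> by listing first the vertex from which the cevian is drawn.
\<close>

definition cevian_trace :: "real^2 \<Rightarrow> real^2 \<Rightarrow> real^2 \<Rightarrow> ext_point \<Rightarrow> ext_point" where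
  "cevian_trace U V W P =
     meet_point (line_through (Ordinary U) P) (line_through (Ordinary V) (Ordinary W))"

definition isotomic_trace :: "real^2 \<Rightarrow> real^2 \<Rightarrow> real^2 \<Rightarrow> ext_point \<Rightarrow> ext_point" where
  "isotomic_trace U V W P = point_reflection (midpoint V W) (cevian_trace U V W P)"

definition isotomic_conjugate :: "real^2 \<Rightarrow> real^2 \<Rightarrow> real^2 \<Rightarrow> ext_point \<Rightarrow> ext_point" where
  "isotomic_conjugate A B C P =
     (THE X. X \<in> line_through (Ordinary A) (isotomic_trace A B C P)
           \<and> X \<in> line_through (Ordinary B) (isotomic_trace B A C P)
           \<and> X \<in> line_through (Ordinary C) (isotomic_trace C A B P))"

text \<open>
  The vertices belong to this image: for \<open>P\<close> the infinite point of \<open>BC\<close>, the traces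
  \<open>D = D\<^sub>3 = P\<close>, \<open>E = C\<close>, \<open>F = B\<close>, \<open>E\<^sub>3 = F\<^sub>3 = A\<close> give the isotomic conjugate \<open>A\<close>.
\<close>

definition steiner_circumellipse :: "real^2 \<Rightarrow> real^2 \<Rightarrow> real^2 \<Rightarrow> ext_point set" where
  "steiner_circumellipse A B C = isotomic_conjugate A B C ` line_at_infinity"

definition T_map :: "real^2 \<Rightarrow> real^2 \<Rightarrow> real^2 \<Rightarrow> ext_point \<Rightarrow> ext_point \<Rightarrow> ext_point" where
  "T_map A B C P =
     triangle_map A B C (cevian_trace A B C P) (cevian_trace B A C P) (cevian_trace C A B P)"

text \<open>\<open>T'_map A B C P\<close> is the map written \<open>T\<close> with index \<open>P' = \<iota>(P)\<close>, given by \<open>D\<^sub>3E\<^sub>3F\<^sub>3\<close>.\<close>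

definition T'_map :: "real^2 \<Rightarrow> real^2 \<Rightarrow> real^2 \<Rightarrow> ext_point \<Rightarrow> ext_point \<Rightarrow> ext_point" where
  "T'_map A B C P =
     triangle_map A B C (isotomic_trace A B C P) (isotomic_trace B A C P) (isotomic_trace C A B P)"

end

theory Submission imports Defs begin

text \<open>
  The proof is a computation in homogeneous barycentric coordinates with respect to \<open>ABC\<close>. A nonzero
  vector \<open>(x, y, z)\<close> stands for the centre of mass of the weights \<open>x, y, z\<close> at \<open>A, B, C\<close>; it is
  infinite exactly when \<open>x + y + z = 0\<close>. This identifies the extended plane with the projective plane
  over \<open>real^3\<close>: lines are the zero sets of nonzero linear forms, and both joining points and
  intersecting lines are given by the cross product (\<open>point_eq_iff\<close>, \<open>line_through_points\<close>,
  \<open>meet_point_lines\<close>).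

  Let \<open>P = (x : y : z)\<close>. Avoiding the sides of \<open>ABC\<close> means \<open>x, y, z \<noteq> 0\<close>, and avoiding those of the
  anticomplementary triangle means \<open>y + z, x + z, x + y \<noteq> 0\<close>, so that all traces are ordinary.
  Reflection in the midpoint of a side swaps two coordinates, whence \<open>D = (0 : y : z)\<close> and
  \<open>D\<^sub>3 = (0 : z : y)\<close>. The isotomic conjugate is therefore \<open>(yz : xz : xy)\<close>, and \<open>P\<close> lies on the
  Steiner circumellipse iff \<open>s = xy + yz + zx\<close> vanishes (\<open>steiner_circumellipse_bary\<close>).

  An affine map is determined by the images of \<open>A, B, C\<close> and preserves weighted means
  (\<open>affine_map_eqI\<close>, \<open>triangle_map_points\<close>). So the composite of the two maps has to be compared with
  the inverse complement map only at the vertices. It sends \<open>A\<close> to the image of \<open>D\<^sub>3\<close> under the map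
  onto \<open>DEF\<close>, which is the mean of \<open>E\<close> and \<open>F\<close> with weights \<open>z\<close> and \<open>y\<close>, that is
  \<open>(zx/(x+z) + yx/(x+y) : y\<^sup>2/(x+y) : z\<^sup>2/(x+z))\<close>. The first coordinate plus the second is \<open>s/(x+z)\<close>,
  and plus the third is \<open>s/(x+y)\<close> (\<open>cevian_weights_sum\<close>). Hence this point is \<open>(-1 : 1 : 1)\<close>, the
  vertex of the anticomplementary triangle belonging to \<open>A\<close>, iff \<open>s = 0\<close>; the other two vertices
  behave in the same way.
\<close>

unbundle cross3_syntax

section \<open>Vectors in two and three dimensions\<close>

definition area2 :: "real^2 \<Rightarrow> real^2 \<Rightarrow> real" where
  "area2 p q = p$1 * q$2 - p$2 * q$1"

lemma collinear_of_area2_eq_0: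
  fixes A B C :: "real^2"
  assumes "area2 (B - A) (C - A) = 0"
  shows "collinear {A, B, C}"
proof -
  define p q where "p = B - A" and "q = C - A"
  have 0: "p$1 * q$2 = p$2 * q$1"
    using assms by (simp add: area2_def p_def q_def)
  have "collinear {0, p, q}"
  proof (cases "p = 0")
    case False
    then consider "p$1 \<noteq> 0" | "p$2 \<noteq> 0"
      by (auto simp: vec_eq_iff forall_2)
    then have "\<exists>c. q = c *\<^sub>R p"
    proof cases
      case 1
      then have "q = (q$1 / p$1) *\<^sub>R p"
        using 0 by (simp add: vec_eq_iff forall_2 field_simps)
      then show ?thesis ..
    next
      case 2
      then have "q = (q$2 / p$2) *\<^sub>R p"
        using 0 by (simp add: vec_eq_iff forall_2 field_simps)
      then show ?thesis ..
    qed
    then show ?thesis by (auto simp: collinear_lemma)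
  qed simp
  then show ?thesis
    using collinear_3[of B A C] by (simp add: p_def q_def insert_commute)
qed

lemma cross3_eq_0_multiple:
  fixes u v :: "real^3"
  assumes "u \<times> v = 0" "u \<noteq> 0"
  obtains c where "v = c *\<^sub>R u"
proof -
  have "(u \<bullet> v) *\<^sub>R u = (u \<bullet> u) *\<^sub>R v"
    using assms(1) Lagrange[of u u v] by simp
  moreover have "u \<bullet> u \<noteq> 0" using assms(2) by simp
  ultimately have "v = ((u \<bullet> v) / (u \<bullet> u)) *\<^sub>R u"
    by (metis (no_types) divide_inverse_commute right_inverse scaleR_one scaleR_scaleR mult.commute)
  then show ?thesis by (rule that)
qed

text \<open>
  This is the uniqueness behind both \<open>line_through\<close> and \<open>meet_point\<close>: two distinct points lie on
  one line only, and two distinct lines have one common point only.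
\<close>

lemma orthogonal_to_both_multiple:
  fixes l u v :: "real^3"
  assumes "l \<bullet> u = 0" "l \<bullet> v = 0" "u \<times> v \<noteq> 0"
  obtains c where "l = c *\<^sub>R (u \<times> v)"
proof -
  have "(u \<times> v) \<times> l = 0"
    using assms cross_skew[of "u \<times> v" l] by (simp add: Lagrange)
  then show ?thesis using assms(3) that by (rule cross3_eq_0_multiple)
qed

lemma cross_vector:
  "vector [a, b, c] \<times> vector [x, y, z] = (vector [b * z - c * y, c * x - a * z, a * y - b * x] :: real^3)"
  by (simp add: cross3_def vector_3)

lemma vector_eq_0_iff: "vector [x, y, z] = (0 :: real^3) \<longleftrightarrow> x = 0 \<and> y = 0 \<and> z = 0"
  by (simp add: vec_eq_iff forall_3 vector_3)

lemma inner_vector: "vector [a, b, c] \<bullet> (vector [x, y, z] :: real^3) = a * x + b * y + c * z"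
  by (simp add: inner_vec_def sum_3 vector_3)

lemma vector_cases:
  obtains x y z where "u = (vector [x, y, z] :: real^3)"
  by (rule that[of "u$1" "u$2" "u$3"]) (simp add: vec_eq_iff forall_3 vector_3)

section \<open>Directions and affine maps\<close>

lemma Rep_direction_span:
  fixes w :: "real^2"
  assumes "w \<noteq> 0"
  shows "Rep_direction (Abs_direction (span {w})) = span {w}"
  using assms by (subst Abs_direction_inverse) (auto simp: subspace_span dim_singleton)

lemma direction_span_obtain:
  obtains w where "w \<noteq> 0" "d = Abs_direction (span {w})"
proof -
  have S: "subspace (Rep_direction d)" "dim (Rep_direction d) = 1"
    using Rep_direction[of d] by auto
  then obtain b where b: "b \<subseteq> Rep_direction d" "independent b" "Rep_direction d \<subseteq> span b" "card b = 1"
    by (metis basis_exists)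
  then obtain w where w: "b = {w}" by (auto simp: card_1_singleton_iff)
  have "Rep_direction d = span {w}"
    using b w S(1) by (metis span_minimal subset_antisym)
  then have "d = Abs_direction (span {w})" by (metis Rep_direction_inverse)
  moreover have "w \<noteq> 0" using b(2) w dependent_zero by auto
  ultimately show ?thesis using that by blast
qed

lemma Abs_direction_span_eq_iff:
  fixes v w :: "real^2"
  assumes "v \<noteq> 0" "w \<noteq> 0"
  shows "Abs_direction (span {v}) = Abs_direction (span {w}) \<longleftrightarrow> (\<exists>c. c \<noteq> 0 \<and> w = c *\<^sub>R v)"
proof
  assume "Abs_direction (span {v}) = Abs_direction (span {w})"
  then have "span {v} = span {w}" using assms Rep_direction_span by metis
  then have "w \<in> span {v}" by (simp add: span_base)
  then show "\<exists>c. c \<noteq> 0 \<and> w = c *\<^sub>R v" using assms(2) by (auto simp: span_singleton)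
next
  assume "\<exists>c. c \<noteq> 0 \<and> w = c *\<^sub>R v"
  then obtain c where c: "c \<noteq> 0" "w = c *\<^sub>R v" by blast
  have "w \<in> span {v}" using c by (auto simp: span_singleton)
  moreover have "v = (1/c) *\<^sub>R w" using c by simp
  then have "v \<in> span {w}" by (auto simp: span_singleton)
  ultimately have "span {v} = span {w}"
    by (simp add: span_eq)
  then show "Abs_direction (span {v}) = Abs_direction (span {w})" by simp
qed

text \<open>
  On infinite points the composition rule needs the image of a direction under a linear map to be a
  direction again; this is where injectivity of the linear part enters.
\<close>

lemma affine_map_comp:
  assumes "affine_map f" "affine_map h"
  shows "affine_map (f \<circ> h)"
proof -
  obtain g c where f: "linear g" "inj g" "f = ext_affine g c" using assms(1) by (auto simp: affine_map_def)
  obtain g' c' where h: "linear g'" "inj g'" "h = ext_affine g' c'" using assms(2) by (auto simp: affine_map_def)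
  have "Rep_direction (Abs_direction (g' ` Rep_direction d)) = g' ` Rep_direction d" for d
  proof (rule Abs_direction_inverse)
    have "subspace (Rep_direction d)" "dim (Rep_direction d) = 1" using Rep_direction[of d] by auto
    then show "g' ` Rep_direction d \<in> {S. subspace S \<and> dim S = 1}"
      using h linear_subspace_image dim_image_eq[of g' "Rep_direction d"] by (auto intro: inj_on_subset)
  qed
  then have "(f \<circ> h) X = ext_affine (g \<circ> g') (g c' + c) X" for X
    using f(1) by (cases X) (simp_all add: f(3) h(3) linear_add image_image)
  then have "f \<circ> h = ext_affine (g \<circ> g') (g c' + c)" by blast
  moreover have "linear (g \<circ> g')" "inj (g \<circ> g')"
    using f h by (auto intro: linear_compose inj_compose)
  ultimately show ?thesis unfolding affine_map_def by blast
qed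

section \<open>Homogeneous barycentric coordinates\<close>

definition mass :: "real^3 \<Rightarrow> real" where
  "mass u = u$1 + u$2 + u$3"

lemma mass_linear [simp]:
  "mass 0 = 0" "mass (u + v) = mass u + mass v" "mass (u - v) = mass u - mass v"
  "mass (c *\<^sub>R u) = c * mass u" "mass (- u) = - mass u"
  by (simp_all add: mass_def algebra_simps)

lemma inner_ones_eq_mass: "vector [1, 1, 1] \<bullet> u = mass u"
  by (simp add: mass_def inner_vec_def sum_3 vector_3)

locale triangle =
  fixes A B C :: "real^2"
  assumes noncollinear: "\<not> collinear {A, B, C}"
begin

lemma area2_nonzero: "area2 (B - A) (C - A) \<noteq> 0"
  using noncollinear collinear_of_area2_eq_0 by blast

definition weigh :: "real^3 \<Rightarrow> real^2" where
  "weigh u = u$1 *\<^sub>R A + u$2 *\<^sub>R B + u$3 *\<^sub>R C"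

lemma weigh_linear [simp]:
  "weigh 0 = 0" "weigh (u + v) = weigh u + weigh v" "weigh (u - v) = weigh u - weigh v"
  "weigh (c *\<^sub>R u) = c *\<^sub>R weigh u" "weigh (- u) = - weigh u"
  by (simp_all add: weigh_def algebra_simps)

text \<open>
  Together, \<open>mass\<close> and \<open>weigh\<close> form a linear isomorphism from \<open>real^3\<close> to
  \<open>real \<times> real^2\<close>; this is injectivity, and \<open>coords\<close> below is the inverse, written with Cramer's
  rule.
\<close>

lemma mass_weigh_eq_0:
  assumes "mass u = 0" "weigh u = 0"
  shows "u = 0"
proof -
  have u1: "u$1 = - u$2 - u$3" using assms(1) by (simp add: mass_def)
  have w: "u$2 * (B - A)$1 + u$3 * (C - A)$1 = 0" "u$2 * (B - A)$2 + u$3 * (C - A)$2 = 0"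
    using assms(2) by (simp_all add: weigh_def u1 vec_eq_iff forall_2 algebra_simps)
  have "u$2 * area2 (B - A) (C - A)
      = (u$2 * (B - A)$1 + u$3 * (C - A)$1) * (C - A)$2 - (u$2 * (B - A)$2 + u$3 * (C - A)$2) * (C - A)$1"
    unfolding area2_def by algebra
  then have "u$2 * area2 (B - A) (C - A) = 0"
    unfolding w by simp
  moreover have "u$3 * area2 (B - A) (C - A)
      = (u$2 * (B - A)$2 + u$3 * (C - A)$2) * (B - A)$1 - (u$2 * (B - A)$1 + u$3 * (C - A)$1) * (B - A)$2"
    unfolding area2_def by algebra
  then have "u$3 * area2 (B - A) (C - A) = 0"
    unfolding w by simp
  ultimately show ?thesis
    using area2_nonzero u1 by (simp add: vec_eq_iff forall_3)
qed

lemma mass_weigh_inject: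
  assumes "mass u = mass v" "weigh u = weigh v"
  shows "u = v"
  using mass_weigh_eq_0[of "u - v"] assms by simp

definition coords :: "real \<Rightarrow> real^2 \<Rightarrow> real^3" where
  "coords m w = (let \<beta> = area2 (w - m *\<^sub>R A) (C - A) / area2 (B - A) (C - A);
                     \<gamma> = area2 (B - A) (w - m *\<^sub>R A) / area2 (B - A) (C - A)
                 in vector [m - \<beta> - \<gamma>, \<beta>, \<gamma>])"

lemma mass_coords [simp]: "mass (coords m w) = m"
  by (simp add: coords_def Let_def mass_def vector_3)

lemma weigh_coords [simp]: "weigh (coords m w) = w"
proof -
  define p q x where "p = B - A" and "q = C - A" and "x = w - m *\<^sub>R A"
  have nz: "area2 p q \<noteq> 0" using area2_nonzero by (simp add: p_def q_def)
  have "area2 x q *\<^sub>R p + area2 p x *\<^sub>R q = area2 p q *\<^sub>R x"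
    by (simp add: vec_eq_iff forall_2 area2_def algebra_simps)
  then have "(1 / area2 p q) *\<^sub>R (area2 x q *\<^sub>R p + area2 p x *\<^sub>R q) = x"
    using nz by simp
  then have "(area2 x q / area2 p q) *\<^sub>R p + (area2 p x / area2 p q) *\<^sub>R q = x"
    by (simp add: scaleR_add_right)
  moreover have "weigh (coords m w) =
      m *\<^sub>R A + (area2 x q / area2 p q) *\<^sub>R p + (area2 p x / area2 p q) *\<^sub>R q"
    by (simp add: coords_def Let_def weigh_def vector_3 p_def q_def x_def algebra_simps)
  ultimately show ?thesis by (simp add: x_def add.assoc)
qed

text \<open>
  For total mass 0 the weighted sum is a vector rather than a position, and it gives the direction of
  the infinite point. The vector 0 stands for no point, so it is excluded
  wherever coordinates are compared.
\<close>

definition point :: "real^3 \<Rightarrow> ext_point" where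
  "point u = (if mass u = 0 then Infinite (Abs_direction (span {weigh u}))
              else Ordinary ((1 / mass u) *\<^sub>R weigh u))"

lemma point_surj:
  obtains u where "u \<noteq> 0" "X = point u"
proof (cases X)
  case (Ordinary x)
  have "X = point (coords 1 x)" by (simp add: point_def Ordinary)
  moreover have "coords 1 x \<noteq> 0" using mass_coords[of 1 x] by (metis mass_linear(1) zero_neq_one)
  ultimately show ?thesis using that by blast
next
  case (Infinite d)
  obtain w where w: "w \<noteq> 0" "d = Abs_direction (span {w})" by (rule direction_span_obtain)
  have "X = point (coords 0 w)" by (simp add: point_def Infinite w)
  moreover have "coords 0 w \<noteq> 0" using w(1) weigh_coords[of 0 w] by (metis weigh_linear(1))
  ultimately show ?thesis using that by blast
qed

lemma point_eq_iff_multiple: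
  assumes "u \<noteq> 0" "v \<noteq> 0"
  shows "point u = point v \<longleftrightarrow> (\<exists>c. c \<noteq> 0 \<and> v = c *\<^sub>R u)"
proof (cases "mass u = 0")
  case True
  then have nu: "weigh u \<noteq> 0" using assms mass_weigh_eq_0 by blast
  show ?thesis
  proof (cases "mass v = 0")
    case v: True
    then have nv: "weigh v \<noteq> 0" using assms mass_weigh_eq_0 by blast
    have "(\<exists>c. c \<noteq> 0 \<and> weigh v = c *\<^sub>R weigh u) \<longleftrightarrow> (\<exists>c. c \<noteq> 0 \<and> v = c *\<^sub>R u)"
      using mass_weigh_inject True v by (metis mass_linear(4) mult_zero_right weigh_linear(4))
    then show ?thesis
      using Abs_direction_span_eq_iff[OF nu nv] by (simp add: point_def True v)
  next
    case False
    then show ?thesis using True by (auto simp: point_def)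
  qed
next
  case u: False
  show ?thesis
  proof (cases "mass v = 0")
    case True
    then show ?thesis using u by (auto simp: point_def)
  next
    case v: False
    show ?thesis
    proof
      assume "point u = point v"
      then have "(1 / mass u) *\<^sub>R weigh u = (1 / mass v) *\<^sub>R weigh v"
        using u v by (simp add: point_def)
      then have "mass v *\<^sub>R ((1 / mass u) *\<^sub>R weigh u) = mass v *\<^sub>R ((1 / mass v) *\<^sub>R weigh v)"
        by simp
      then have "weigh v = (mass v / mass u) *\<^sub>R weigh u" using v by simp
      then have "v = (mass v / mass u) *\<^sub>R u"
        using u by (intro mass_weigh_inject) simp_all
      then show "\<exists>c. c \<noteq> 0 \<and> v = c *\<^sub>R u" using u v by (metis divide_eq_0_iff)
    next
      assume "\<exists>c. c \<noteq> 0 \<and> v = c *\<^sub>R u"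
      then show "point u = point v" using u by (auto simp: point_def)
    qed
  qed
qed

lemma point_scale: 
  assumes "c \<noteq> 0"
  shows "point (c *\<^sub>R u) = point u"
proof (cases "u = 0")
  case False
  then show ?thesis using assms point_eq_iff_multiple[of u "c *\<^sub>R u"] by auto
qed simp

lemma point_eq_iff:
  assumes "u \<noteq> 0" "v \<noteq> 0"
  shows "point u = point v \<longleftrightarrow> u \<times> v = 0"
proof
  assume "u \<times> v = 0"
  then obtain c where "v = c *\<^sub>R u" using assms(1) by (rule cross3_eq_0_multiple)
  then show "point u = point v" using assms point_eq_iff_multiple by (metis scale_eq_0_iff)
qed (use assms point_eq_iff_multiple in \<open>auto simp: cross_mult_right\<close>)

section \<open>Lines and their intersections\<close>

definition line :: "real^3 \<Rightarrow> ext_point set" where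
  "line l = {point u | u. u \<noteq> 0 \<and> l \<bullet> u = 0}"

lemma point_in_line_iff:
  assumes "u \<noteq> 0"
  shows "point u \<in> line l \<longleftrightarrow> l \<bullet> u = 0"
proof
  assume "point u \<in> line l"
  then obtain v where v: "v \<noteq> 0" "l \<bullet> v = 0" "point v = point u" by (auto simp: line_def)
  then obtain c where "u = c *\<^sub>R v" using point_eq_iff_multiple assms by metis
  then show "l \<bullet> u = 0" using v by simp
qed (use assms in \<open>auto simp: line_def\<close>)

lemma line_scale:
  assumes "c \<noteq> 0"
  shows "line (c *\<^sub>R l) = line l"
  using assms by (simp add: line_def)

lemma line_at_infinity_eq: "line_at_infinity = line (vector [1, 1, 1])"
proof -
  have "vector [1, 1, 1] \<bullet> u = mass u" for u :: "real^3"
    by (rule inner_ones_eq_mass)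
  then have "X \<in> line_at_infinity \<longleftrightarrow> X \<in> line (vector [1, 1, 1])" for X
    using point_surj[of X] point_in_line_iff[of _ "vector [1, 1, 1]"]
    by (metis (no_types, lifting) line_at_infinity_def point_def ext_point.distinct(1) ext_point.exhaust rangeE rangeI)
  then show ?thesis by blast
qed

text \<open>
  An ordinary line is given by a position \<open>u\<close> and a direction \<open>v\<close>. A point \<open>x\<close> satisfies the equation
  \<open>u \<times> v\<close> iff \<open>x\<close> is a combination of \<open>u\<close> and \<open>v\<close>, and dividing such a combination by its mass gives
  exactly the points \<open>u + t v\<close> and, for mass 0, the infinite point \<open>v\<close>.
\<close>

lemma ordinary_line_eq:
  assumes u: "mass u = 1" and v: "mass v = 0" "v \<noteq> 0"
  shows "ordinary_line (weigh u) (Abs_direction (span {weigh v})) = line (u \<times> v)" (is "?L = _")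
proof -
  have nv: "weigh v \<noteq> 0" using v mass_weigh_eq_0 by blast
  have Lord: "Ordinary x \<in> ?L \<longleftrightarrow> (\<exists>t. x = weigh u + t *\<^sub>R weigh v)" for x
    unfolding ordinary_line_def Rep_direction_span[OF nv] by (auto simp: span_singleton)
  have Linf: "Infinite d \<in> ?L \<longleftrightarrow> d = Abs_direction (span {weigh v})" for d
    by (auto simp: ordinary_line_def)
  have "point x \<in> ?L \<longleftrightarrow> point x \<in> line (u \<times> v)" if x: "x \<noteq> 0" for x
  proof
    assume L: "point x \<in> ?L"
    show "point x \<in> line (u \<times> v)"
    proof (cases "mass x = 0")
      case True
      then have "point x = point v" using L v(1) by (simp add: Linf point_def)
      then obtain c where "v = c *\<^sub>R x" "c \<noteq> 0" using point_eq_iff_multiple x v(2) by blast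
      moreover have "(u \<times> v) \<bullet> v = 0" by (simp add: dot_cross_self)
      ultimately have "(u \<times> v) \<bullet> x = 0" by (metis inner_scaleR_right mult_eq_0_iff)
      then show ?thesis by (simp add: point_in_line_iff x)
    next
      case False
      then obtain t where "(1 / mass x) *\<^sub>R weigh x = weigh u + t *\<^sub>R weigh v"
        using L Lord by (auto simp: point_def)
      then have "(1 / mass x) *\<^sub>R x = u + t *\<^sub>R v"
        using False u v by (intro mass_weigh_inject) simp_all
      then have "(u \<times> v) \<bullet> ((1 / mass x) *\<^sub>R x) = 0"
        by (simp only: inner_add_right inner_scaleR_right dot_cross_self mult_zero_right add_0_right)
      then show ?thesis using False by (simp add: point_in_line_iff x)
    qed
  next
    assume "point x \<in> line (u \<times> v)"
    then have "x \<bullet> (u \<times> v) = 0" by (simp add: point_in_line_iff x inner_commute)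
    define y where "y = x - mass x *\<^sub>R u"
    have my: "mass y = 0" by (simp add: y_def u)
    \<comment> \<open>Both \<open>v\<close> and \<open>y\<close> have mass 0, so their cross product is a multiple of \<open>(1, 1, 1)\<close>;
       its product with \<open>u\<close> vanishes while \<open>u\<close> has mass 1, so the multiple is 0.\<close>
    have "\<exists>t. y = t *\<^sub>R v"
    proof -
      have "v \<times> y = 0"
      proof -
        define n :: "real^3" where "n = vector [1, 1, 1]"
        have n: "n \<bullet> x = mass x" for x
          by (simp add: n_def inner_ones_eq_mass)
        have "n \<times> (v \<times> y) = 0" by (simp add: Lagrange n my v)
        moreover have "n \<noteq> 0" using n[of u] u by auto
        ultimately obtain k where k: "v \<times> y = k *\<^sub>R n" by (rule cross3_eq_0_multiple)
        have "u \<bullet> (v \<times> y) = y \<bullet> (u \<times> v)"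
          using cross_triple[of u v y] by (simp add: inner_commute)
        also have "\<dots> = 0"
          using \<open>x \<bullet> (u \<times> v) = 0\<close> by (simp add: y_def inner_diff_left dot_cross_self)
        finally have "k = 0" using k n[of u] u by (simp add: inner_commute)
        then show ?thesis using k by simp
      qed
      then show ?thesis using v(2) cross3_eq_0_multiple by blast
    qed
    then obtain t where t: "x = mass x *\<^sub>R u + t *\<^sub>R v" by (auto simp: y_def algebra_simps)
    show "point x \<in> ?L"
    proof (cases "mass x = 0")
      case True
      then have "x = t *\<^sub>R v" using t by simp
      then have "point x = point v" using x by (metis point_scale scale_zero_left)
      then show ?thesis using v(1) by (simp add: Linf point_def)
    next
      case False
      have "(1 / mass x) *\<^sub>R weigh x = (1 / mass x) *\<^sub>R weigh (mass x *\<^sub>R u + t *\<^sub>R v)"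
        using t by simp
      also have "\<dots> = weigh u + (t / mass x) *\<^sub>R weigh v"
        using False by (simp add: scaleR_add_right)
      finally show ?thesis using False by (auto simp: Lord point_def)
    qed
  qed
  then have "X \<in> ?L \<longleftrightarrow> X \<in> line (u \<times> v)" for X
    by (metis point_surj)
  then show ?thesis by blast
qed


text \<open>
  The infinite point \<open>v\<close> of the line with equation \<open>l\<close> is its intersection with the line at infinity,
  \<open>l \<times> (1, 1, 1)\<close>. This degenerates only when \<open>l\<close> is the line at infinity itself. Otherwise \<open>v \<times> l\<close>
  is a second point on the line, and its mass \<open>v \<bullet> v\<close> is not 0.
\<close>

lemma nonzero_line_in_ext_lines:
  assumes "l \<noteq> 0"
  shows "line l \<in> ext_lines"
proof -
  define n :: "real^3" where "n = vector [1, 1, 1]"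
  have n: "n \<bullet> x = mass x" for x
    by (simp add: n_def inner_ones_eq_mass)
  define v where "v = l \<times> n"
  show ?thesis
  proof (cases "v = 0")
    case True
    then obtain c where c: "n = c *\<^sub>R l" unfolding v_def using assms by (rule cross3_eq_0_multiple)
    have "n \<noteq> 0" by (simp add: n_def vec_eq_iff forall_3 vector_3)
    then have "c \<noteq> 0" using c by auto
    then have "line l = line_at_infinity"
      using line_scale[of c l] c by (simp add: line_at_infinity_eq flip: n_def)
    then show ?thesis by (simp add: ext_lines_def)
  next
    case False
    have nv: "n \<bullet> v = 0" by (simp add: v_def dot_cross_self)
    have "n \<bullet> (v \<times> l) = v \<bullet> v"
      using cross_triple[of v l n] by (simp add: inner_commute flip: v_def)
    define u where "u = (1 / (v \<bullet> v)) *\<^sub>R (v \<times> l)"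
    have "mass u = 1"
      using False \<open>n \<bullet> (v \<times> l) = v \<bullet> v\<close> by (simp add: u_def flip: n)
    moreover have "mass v = 0" using nv n by simp
    ultimately have *: "ordinary_line (weigh u) (Abs_direction (span {weigh v})) = line (u \<times> v)"
      using False by (rule ordinary_line_eq)
    have "(v \<times> l) \<times> v = (v \<bullet> v) *\<^sub>R l"
      using cross_skew[of "v \<times> l" v] by (simp add: Lagrange) (simp add: v_def dot_cross_self)
    then have "u \<times> v = l" using False by (simp add: u_def cross_mult_left)
    then show ?thesis using * by (auto simp: ext_lines_def)
  qed
qed

lemma ext_lines_obtain:
  assumes "m \<in> ext_lines"
  obtains l where "l \<noteq> 0" "m = line l"
proof (cases "m = line_at_infinity")
  case True
  have "vector [1, 1, 1] \<noteq> (0 :: real^3)" by (simp add: vec_eq_iff forall_3 vector_3)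
  then show ?thesis using True line_at_infinity_eq that by blast
next
  case False
  then obtain p d where m: "m = ordinary_line p d" using assms by (auto simp: ext_lines_def)
  obtain w where w: "w \<noteq> 0" "d = Abs_direction (span {w})" by (rule direction_span_obtain)
  define u v where "u = coords 1 p" and "v = coords 0 w"
  have v: "v \<noteq> 0" using w(1) weigh_coords[of 0 w] unfolding v_def by (metis weigh_linear(1))
  have uv: "mass u = 1" "mass v = 0" "weigh u = p" "weigh v = w" by (simp_all add: u_def v_def)
  have "u \<times> v \<noteq> 0"
  proof
    assume "u \<times> v = 0"
    moreover have "u \<noteq> 0" using uv by auto
    ultimately obtain c where "v = c *\<^sub>R u" by (rule cross3_eq_0_multiple)
    then show False using uv v by simp
  qed
  moreover have "m = line (u \<times> v)" using ordinary_line_eq[of u v] uv v m w by simp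
  ultimately show ?thesis by (rule that)
qed

lemma line_through_points:
  assumes "u \<times> v \<noteq> 0"
  shows "line_through (point u) (point v) = line (u \<times> v)"
  unfolding line_through_def
proof (rule the_equality)
  have nz: "u \<noteq> 0" "v \<noteq> 0" using assms by auto
  show "line (u \<times> v) \<in> ext_lines \<and> point u \<in> line (u \<times> v) \<and> point v \<in> line (u \<times> v)"
    using assms nz nonzero_line_in_ext_lines by (simp add: point_in_line_iff dot_cross_self)
  fix m assume m: "m \<in> ext_lines \<and> point u \<in> m \<and> point v \<in> m"
  then obtain l where l: "l \<noteq> 0" "m = line l" using ext_lines_obtain by blast
  then have "l \<bullet> u = 0" "l \<bullet> v = 0" using m nz by (simp_all add: point_in_line_iff)
  then obtain c where c: "l = c *\<^sub>R (u \<times> v)" using assms by (rule orthogonal_to_both_multiple)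
  then have "c \<noteq> 0" using l by auto
  then show "m = line (u \<times> v)" using l c line_scale by simp
qed

lemma common_point_unique:
  assumes "l \<times> m \<noteq> 0" "u \<noteq> 0" "l \<bullet> u = 0" "m \<bullet> u = 0"
  shows "point u = point (l \<times> m)"
proof -
  obtain c where c: "u = c *\<^sub>R (l \<times> m)"
    using assms orthogonal_to_both_multiple by (metis inner_commute)
  then have "c \<noteq> 0" using assms(2) by auto
  then show ?thesis using c point_scale by simp
qed

lemma meet_point_lines:
  assumes "l \<times> m \<noteq> 0"
  shows "meet_point (line l) (line m) = point (l \<times> m)"
  unfolding meet_point_def
proof (rule the_equality)
  show "point (l \<times> m) \<in> line l \<and> point (l \<times> m) \<in> line m"
    using assms by (simp add: point_in_line_iff dot_cross_self)
  fix X assume X: "X \<in> line l \<and> X \<in> line m"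
  obtain u where u: "u \<noteq> 0" "X = point u" by (rule point_surj)
  then show "X = point (l \<times> m)"
    using X assms common_point_unique by (simp add: point_in_line_iff)
qed

lemma triangle_vertices:
  "Ordinary A = point (vector [1, 0, 0])"
  "Ordinary B = point (vector [0, 1, 0])"
  "Ordinary C = point (vector [0, 0, 1])"
  by (simp_all add: point_def mass_def weigh_def vector_3)

section \<open>Traces, isotomic conjugates and the Steiner circumellipse\<close>

definition bary :: "real \<Rightarrow> real \<Rightarrow> real \<Rightarrow> ext_point" where
  "bary x y z = point (vector [x, y, z])"

lemma point_surj_bary:
  obtains x y z where "x \<noteq> 0 \<or> y \<noteq> 0 \<or> z \<noteq> 0" "P = bary x y z"
  by (metis point_surj bary_def vector_cases vector_eq_0_iff)

lemma bary_eq_iff: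
  assumes "x \<noteq> 0 \<or> y \<noteq> 0 \<or> z \<noteq> 0" "x' \<noteq> 0 \<or> y' \<noteq> 0 \<or> z' \<noteq> 0"
  shows "bary x y z = bary x' y' z' \<longleftrightarrow> y * z' = z * y' \<and> z * x' = x * z' \<and> x * y' = y * x'"
  using assms point_eq_iff[of "vector [x, y, z]" "vector [x', y', z']"]
  by (simp add: bary_def cross_vector vector_eq_0_iff)

lemma on_triangle_sides_bary:
  assumes "x \<noteq> 0 \<or> y \<noteq> 0 \<or> z \<noteq> 0"
  shows "on_triangle_sides A B C (bary x y z) \<longleftrightarrow> x = 0 \<or> y = 0 \<or> z = 0"
  using assms
  by (simp add: on_triangle_sides_def on_sides_def triangle_vertices line_through_points cross_vector
      vector_eq_0_iff point_in_line_iff bary_def inner_vector)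

lemma cevian_traces_bary:
  "y \<noteq> 0 \<or> z \<noteq> 0 \<Longrightarrow> cevian_trace A B C (bary x y z) = bary 0 y z"
  "x \<noteq> 0 \<or> z \<noteq> 0 \<Longrightarrow> cevian_trace B A C (bary x y z) = bary x 0 z"
  "x \<noteq> 0 \<or> y \<noteq> 0 \<Longrightarrow> cevian_trace C A B (bary x y z) = bary x y 0"
  by (auto simp: cevian_trace_def triangle_vertices line_through_points cross_vector
      vector_eq_0_iff meet_point_lines bary_def point_eq_iff)

lemma bary_ordinary:
  assumes "x + y + z \<noteq> 0"
  shows "bary x y z = Ordinary ((1 / (x + y + z)) *\<^sub>R (x *\<^sub>R A + y *\<^sub>R B + z *\<^sub>R C))"
  using assms by (simp add: bary_def point_def mass_def weigh_def vector_3)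

lemma bary_infinite:
  assumes "x + y + z = 0"
  shows "\<exists>d. bary x y z = Infinite d"
  using assms by (simp add: bary_def point_def mass_def vector_3)

lemma reflect_in_midpoint_swaps_weights:
  fixes V W :: "real^2"
  assumes "s + t \<noteq> 0"
  shows "midpoint V W - ((1 / (s + t)) *\<^sub>R (s *\<^sub>R V + t *\<^sub>R W) - midpoint V W)
       = (1 / (s + t)) *\<^sub>R (t *\<^sub>R V + s *\<^sub>R W)"
proof -
  have "V + W = (1 / (s + t)) *\<^sub>R ((s + t) *\<^sub>R (V + W))" using assms by simp
  also have "\<dots> = (1 / (s + t)) *\<^sub>R (s *\<^sub>R V + t *\<^sub>R W) + (1 / (s + t)) *\<^sub>R (t *\<^sub>R V + s *\<^sub>R W)"
    by (simp add: algebra_simps flip: scaleR_add_right)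
  finally have "V + W - (1 / (s + t)) *\<^sub>R (s *\<^sub>R V + t *\<^sub>R W) = (1 / (s + t)) *\<^sub>R (t *\<^sub>R V + s *\<^sub>R W)"
    by (simp only: add_diff_cancel_left')
  moreover have "midpoint V W + midpoint V W = V + W"
    by (simp add: midpoint_def flip: scaleR_add_left)
  ultimately show ?thesis by (metis diff_diff_eq2)
qed

text \<open>
  An infinite point of a side is its own reflection, and swapping its two nonzero coordinates only
  changes the sign of the vector, so the rule holds for it as well.
\<close>

lemma point_reflection_on_sides:
  "y \<noteq> 0 \<or> z \<noteq> 0 \<Longrightarrow> point_reflection (midpoint B C) (bary 0 y z) = bary 0 z y"
  "x \<noteq> 0 \<or> z \<noteq> 0 \<Longrightarrow> point_reflection (midpoint A C) (bary x 0 z) = bary z 0 x"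
  "x \<noteq> 0 \<or> y \<noteq> 0 \<Longrightarrow> point_reflection (midpoint A B) (bary x y 0) = bary y x 0"
proof -
  show "point_reflection (midpoint B C) (bary 0 y z) = bary 0 z y" if "y \<noteq> 0 \<or> z \<noteq> 0"
  proof (cases "y + z = 0")
    case True
    moreover have "bary 0 y z = bary 0 z y" using that True by (subst bary_eq_iff) (auto simp: add_eq_0_iff)
    ultimately show ?thesis using bary_infinite[of 0 y z] by auto
  next
    case False
    then show ?thesis
      using reflect_in_midpoint_swaps_weights[of y z B C] by (simp add: bary_ordinary add.commute[of z y])
  qed
  show "point_reflection (midpoint A C) (bary x 0 z) = bary z 0 x" if "x \<noteq> 0 \<or> z \<noteq> 0"
  proof (cases "x + z = 0")
    case True
    moreover have "bary x 0 z = bary z 0 x" using that True by (subst bary_eq_iff) (auto simp: add_eq_0_iff)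
    ultimately show ?thesis using bary_infinite[of x 0 z] by auto
  next
    case False
    then show ?thesis
      using reflect_in_midpoint_swaps_weights[of x z A C] by (simp add: bary_ordinary add.commute[of z x])
  qed
  show "point_reflection (midpoint A B) (bary x y 0) = bary y x 0" if "x \<noteq> 0 \<or> y \<noteq> 0"
  proof (cases "x + y = 0")
    case True
    moreover have "bary x y 0 = bary y x 0" using that True by (subst bary_eq_iff) (auto simp: add_eq_0_iff)
    ultimately show ?thesis using bary_infinite[of x y 0] by auto
  next
    case False
    then show ?thesis
      using reflect_in_midpoint_swaps_weights[of x y A B] by (simp add: bary_ordinary add.commute[of y x])
  qed
qed

lemma isotomic_traces_bary:
  "y \<noteq> 0 \<or> z \<noteq> 0 \<Longrightarrow> isotomic_trace A B C (bary x y z) = bary 0 z y"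
  "x \<noteq> 0 \<or> z \<noteq> 0 \<Longrightarrow> isotomic_trace B A C (bary x y z) = bary z 0 x"
  "x \<noteq> 0 \<or> y \<noteq> 0 \<Longrightarrow> isotomic_trace C A B (bary x y z) = bary y x 0"
  by (simp_all add: isotomic_trace_def cevian_traces_bary point_reflection_on_sides)

text \<open>
  The three cevians have the equations \<open>yq = zr\<close>, \<open>xp = zr\<close>, \<open>xp = yq\<close> in the unknown point
  \<open>(p : q : r)\<close>. One of \<open>x, y, z\<close> may vanish; infinite points on the sides need this, and they get
  the opposite vertex as their conjugate.
\<close>

lemma isotomic_conjugate_bary:
  assumes "y \<noteq> 0 \<or> z \<noteq> 0" "x \<noteq> 0 \<or> z \<noteq> 0" "x \<noteq> 0 \<or> y \<noteq> 0"
  shows "isotomic_conjugate A B C (bary x y z) = bary (y * z) (x * z) (x * y)"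
proof -
  have nz: "y * z \<noteq> 0 \<or> x * z \<noteq> 0 \<or> x * y \<noteq> 0" using assms by auto
  have lines:
    "line_through (Ordinary A) (isotomic_trace A B C (bary x y z)) = line (vector [0, - y, z])"
    "line_through (Ordinary B) (isotomic_trace B A C (bary x y z)) = line (vector [x, 0, - z])"
    "line_through (Ordinary C) (isotomic_trace C A B (bary x y z)) = line (vector [- x, y, 0])"
    unfolding isotomic_traces_bary(1)[OF assms(1)] isotomic_traces_bary(2)[OF assms(2)]
      isotomic_traces_bary(3)[OF assms(3)]
    using assms
    by (auto simp: triangle_vertices bary_def line_through_points cross_vector vector_eq_0_iff)
  have cevians: "(bary p q r \<in> line_through (Ordinary A) (isotomic_trace A B C (bary x y z))
      \<and> bary p q r \<in> line_through (Ordinary B) (isotomic_trace B A C (bary x y z))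
      \<and> bary p q r \<in> line_through (Ordinary C) (isotomic_trace C A B (bary x y z)))
    \<longleftrightarrow> y * q = z * r \<and> x * p = z * r \<and> x * p = y * q" if "p \<noteq> 0 \<or> q \<noteq> 0 \<or> r \<noteq> 0" for p q r
    using that unfolding lines unfolding bary_def
    by (auto simp: point_in_line_iff inner_vector vector_eq_0_iff)
  show ?thesis
    unfolding isotomic_conjugate_def
  proof (rule the_equality, goal_cases)
    case 1
    show ?case using nz by (subst cevians) auto
  next
    case (2 X)
    obtain p q r where X: "p \<noteq> 0 \<or> q \<noteq> 0 \<or> r \<noteq> 0" "X = bary p q r" by (rule point_surj_bary)
    then have "y * q = z * r" "x * p = z * r" "x * p = y * q" using 2 cevians by blast+
    then have "q * (x * y) = r * (x * z)" "r * (y * z) = p * (x * y)" "p * (x * z) = q * (y * z)"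
      by algebra+
    then show ?case using X nz by (simp add: bary_eq_iff)
  qed
qed

text \<open>
  Since isotomic conjugation is an involution off the sides, \<open>P\<close> is a conjugate of an infinite point
  iff \<open>(yz : xz : xy)\<close> is infinite. Infinite points on a side have vertices as conjugates and so
  cannot produce a point with nonzero coordinates.
\<close>

lemma steiner_circumellipse_bary:
  assumes "x \<noteq> 0" "y \<noteq> 0" "z \<noteq> 0"
  shows "bary x y z \<in> steiner_circumellipse A B C \<longleftrightarrow> x * y + y * z + z * x = 0"
proof
  assume "bary x y z \<in> steiner_circumellipse A B C"
  then obtain Q where Q: "Q \<in> line_at_infinity" "bary x y z = isotomic_conjugate A B C Q"
    by (auto simp: steiner_circumellipse_def)
  obtain p q r where pqr: "p \<noteq> 0 \<or> q \<noteq> 0 \<or> r \<noteq> 0" "Q = bary p q r" by (rule point_surj_bary)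
  then have sum0: "p + q + r = 0"
    using Q(1) by (simp add: line_at_infinity_eq bary_def point_in_line_iff vector_eq_0_iff inner_vector)
  then have nz: "q \<noteq> 0 \<or> r \<noteq> 0" "p \<noteq> 0 \<or> r \<noteq> 0" "p \<noteq> 0 \<or> q \<noteq> 0" using pqr(1) by auto
  then have "bary x y z = bary (q * r) (p * r) (p * q)"
    using Q(2) pqr(2) isotomic_conjugate_bary by simp
  moreover have "q * r \<noteq> 0 \<or> p * r \<noteq> 0 \<or> p * q \<noteq> 0" using nz by auto
  ultimately have parallel: "y * (p * q) = z * (p * r)" "z * (q * r) = x * (p * q)" "x * (p * r) = y * (q * r)"
    using assms by (simp_all add: bary_eq_iff)
  then have "p \<noteq> 0" "q \<noteq> 0" "r \<noteq> 0" using nz assms by auto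
  then have k: "y * q = x * p" "z * r = x * p" using parallel by auto
  \<comment> \<open>\<open>x, y, z\<close> are inversely proportional to \<open>p, q, r\<close>, with \<open>xp = yq = zr\<close> as the factor.\<close>
  have "(x * p) * (x * y + y * z + z * x) = x * y * z * (p + q + r)"
    using k by algebra
  then show "x * y + y * z + z * x = 0"
    using sum0 assms(1) \<open>p \<noteq> 0\<close> by simp
next
  assume s: "x * y + y * z + z * x = 0"
  define Q where "Q = bary (y * z) (x * z) (x * y)"
  have "Q \<in> line_at_infinity"
    using assms s by (simp add: Q_def line_at_infinity_eq bary_def point_in_line_iff vector_eq_0_iff inner_vector algebra_simps)
  moreover have "isotomic_conjugate A B C Q = bary (x * z * (x * y)) (y * z * (x * y)) (y * z * (x * z))"
    unfolding Q_def using assms by (subst isotomic_conjugate_bary) auto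
  moreover have "\<dots> = bary x y z"
    using assms by (subst bary_eq_iff) (auto simp: algebra_simps)
  ultimately show "bary x y z \<in> steiner_circumellipse A B C"
    by (metis steiner_circumellipse_def imageI)
qed

section \<open>Affine maps determined by three points\<close>

text \<open>
  A weighted sum of total mass 0 does not see the translation part, so the values
  at the vertices fix the linear part on all vectors \<open>weigh u\<close> with \<open>mass u = 0\<close>, that is on the
  whole plane.
\<close>

lemma affine_map_eqI:
  assumes "affine_map f" "affine_map h"
    and "f (Ordinary A) = h (Ordinary A)" "f (Ordinary B) = h (Ordinary B)" "f (Ordinary C) = h (Ordinary C)"
  shows "f = h"
proof -
  obtain g c where f: "linear g" "f = ext_affine g c" using assms(1) by (auto simp: affine_map_def)
  obtain g' c' where h: "linear g'" "h = ext_affine g' c'" using assms(2) by (auto simp: affine_map_def)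
  have eq: "g A + c = g' A + c'" "g B + c = g' B + c'" "g C + c = g' C + c'"
    using assms(3-5) f h by simp_all
  have "g w = g' w" for w
  proof -
    define u where "u = coords 0 w"
    have u: "mass u = 0" "w = u$1 *\<^sub>R A + u$2 *\<^sub>R B + u$3 *\<^sub>R C"
      using weigh_coords[of 0 w] by (simp_all add: u_def weigh_def)
    have expand: "k w = u$1 *\<^sub>R (k A + b) + u$2 *\<^sub>R (k B + b) + u$3 *\<^sub>R (k C + b)" if "linear k" for k b
    proof -
      have "u$1 *\<^sub>R (k A + b) + u$2 *\<^sub>R (k B + b) + u$3 *\<^sub>R (k C + b)
          = (u$1 *\<^sub>R k A + u$2 *\<^sub>R k B + u$3 *\<^sub>R k C) + mass u *\<^sub>R b"
        by (simp add: mass_def algebra_simps)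
      also have "\<dots> = k w"
        using u that by (simp add: linear_add linear_cmul)
      finally show ?thesis by simp
    qed
    show ?thesis using expand[OF f(1), of c] expand[OF h(1), of c'] eq by simp
  qed
  then have "g = g'" by blast
  then show ?thesis using f h eq by simp
qed

lemma coords_add: "coords (m + n) (w + w') = coords m w + coords n w'"
  by (rule mass_weigh_inject) simp_all

lemma coords_scale: "coords (c * m) (c *\<^sub>R w) = c *\<^sub>R coords m w"
  by (rule mass_weigh_inject) simp_all

text \<open>
  A linear automorphism of the coordinate space that preserves mass maps the plane of mass 1 to itself,
  and there it acts as an affine map of the Euclidean plane. Its linear part is the action on mass 0
  and its translation vector is the image of the origin.
\<close>

lemma affine_map_of_coordinate_map:
  assumes M: "linear M" "\<And>u. M u = 0 \<Longrightarrow> u = 0" "\<And>u. mass (M u) = mass u"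
  shows "\<exists>f. affine_map f \<and> (\<forall>u. mass u \<noteq> 0 \<longrightarrow> f (point u) = point (M u))"
proof -
  define g where "g w = weigh (M (coords 0 w))" for w
  define c where "c = weigh (M (coords 1 0))"
  have lin: "linear g"
  proof (rule linearI)
    show "g (w + w') = g w + g w'" for w w'
      using coords_add[of 0 0 w w'] M(1) by (simp add: g_def linear_add)
    show "g (r *\<^sub>R w) = r *\<^sub>R g w" for r w
      using coords_scale[of r 0 w] M(1) by (simp add: g_def linear_cmul)
  qed
  have "w = 0" if "g w = 0" for w
  proof -
    have "M (coords 0 w) = 0" using that by (intro mass_weigh_eq_0) (simp_all add: g_def M(3))
    then show "w = 0" using M(2) weigh_coords[of 0 w] by (metis weigh_linear(1))
  qed
  then have inj: "inj g" using lin by (simp add: linear_injective_0)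
  have "ext_affine g c (point u) = point (M u)" if "mass u \<noteq> 0" for u
  proof -
    let ?x = "(1 / mass u) *\<^sub>R weigh u"
    have "(1 / mass u) *\<^sub>R u = coords 1 ?x"
      using that by (intro mass_weigh_inject) simp_all
    also have "\<dots> = coords 0 ?x + coords 1 0"
      using coords_add[of 0 1 ?x 0] by simp
    finally have "weigh (M ((1 / mass u) *\<^sub>R u)) = g ?x + c"
      using M(1) by (simp add: g_def c_def linear_add)
    then have "g ?x + c = (1 / mass u) *\<^sub>R weigh (M u)"
      using M(1) by (simp add: linear_cmul)
    then show ?thesis using that by (simp add: point_def M(3))
  qed
  moreover have "affine_map (ext_affine g c)" using lin inj by (auto simp: affine_map_def)
  ultimately show ?thesis by blast
qed

text \<open>
  The triple product is the determinant of the three coordinate vectors; it is nonzero exactly when the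
  target triangle is nondegenerate.
\<close>

lemma triangle_map_points:
  assumes mass: "mass d = 1" "mass e = 1" "mass f = 1"
    and det: "d \<bullet> (e \<times> f) \<noteq> 0"
  shows "affine_map (triangle_map A B C (point d) (point e) (point f))"
    and "mass u \<noteq> 0 \<Longrightarrow> triangle_map A B C (point d) (point e) (point f) (point u)
           = point (u$1 *\<^sub>R d + u$2 *\<^sub>R e + u$3 *\<^sub>R f)"
proof -
  define M where "M u = u$1 *\<^sub>R d + u$2 *\<^sub>R e + u$3 *\<^sub>R f" for u :: "real^3"
  have "linear M"
    by (rule linearI) (simp_all add: M_def algebra_simps)
  moreover have "u = 0" if "M u = 0" for u
  proof -
    \<comment> \<open>Cramer's rule for the coefficients of \<open>d, e, f\<close>.\<close>
    have "M u \<bullet> (e \<times> f) = u$1 * (d \<bullet> (e \<times> f))" "M u \<bullet> (f \<times> d) = u$2 * (d \<bullet> (e \<times> f))"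
      "M u \<bullet> (d \<times> e) = u$3 * (d \<bullet> (e \<times> f))"
      using cross_triple[of e f d] cross_triple[of f d e] cross_triple[of d e f]
      by (simp_all add: M_def inner_add_left dot_cross_self) (simp_all add: inner_commute)
    then show ?thesis using that det by (simp add: vec_eq_iff forall_3)
  qed
  moreover have "mass (M u) = mass u" for u
    using mass by (simp add: M_def) (simp add: mass_def)
  ultimately obtain h where h: "affine_map h" "\<And>u. mass u \<noteq> 0 \<Longrightarrow> h (point u) = point (M u)"
    using affine_map_of_coordinate_map[of M] by blast
  have vertices: "h (Ordinary A) = point d" "h (Ordinary B) = point e" "h (Ordinary C) = point f"
    by (simp_all add: triangle_vertices h(2) mass_def vector_3) (simp_all add: M_def vector_3)
  have "triangle_map A B C (point d) (point e) (point f) = h"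
    unfolding triangle_map_def
  proof (rule the_equality)
    fix k assume "affine_map k \<and> k (Ordinary A) = point d \<and> k (Ordinary B) = point e \<and> k (Ordinary C) = point f"
    then show "k = h" using h(1) vertices by (intro affine_map_eqI) simp_all
  qed (use h(1) vertices in simp)
  then show "affine_map (triangle_map A B C (point d) (point e) (point f))"
    and "mass u \<noteq> 0 \<Longrightarrow> triangle_map A B C (point d) (point e) (point f) (point u)
           = point (u$1 *\<^sub>R d + u$2 *\<^sub>R e + u$3 *\<^sub>R f)"
    using h by (simp_all add: M_def)
qed

text \<open>
  The preceding formula for arbitrary homogeneous coordinates: each of them is first scaled to mass 1,
  since images are weighted means of the actual points.
\<close>

lemma triangle_map_weighted:
  assumes mass: "mass d \<noteq> 0" "mass e \<noteq> 0" "mass f \<noteq> 0"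
    and det: "d \<bullet> (e \<times> f) \<noteq> 0"
  shows "affine_map (triangle_map A B C (point d) (point e) (point f))"
    and "mass u \<noteq> 0 \<Longrightarrow> triangle_map A B C (point d) (point e) (point f) (point u)
           = point ((u$1 / mass d) *\<^sub>R d + (u$2 / mass e) *\<^sub>R e + (u$3 / mass f) *\<^sub>R f)"
proof -
  define d' e' f' where
    "d' = (1 / mass d) *\<^sub>R d" and "e' = (1 / mass e) *\<^sub>R e" and "f' = (1 / mass f) *\<^sub>R f"
  have "mass d' = 1" "mass e' = 1" "mass f' = 1"
    using mass by (simp_all add: d'_def e'_def f'_def)
  moreover have "d' \<bullet> (e' \<times> f') \<noteq> 0"
    using mass det by (simp add: d'_def e'_def f'_def cross_mult_left cross_mult_right)
  moreover have "point d' = point d" "point e' = point e" "point f' = point f"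
    using mass by (simp_all add: d'_def e'_def f'_def point_scale)
  ultimately show "affine_map (triangle_map A B C (point d) (point e) (point f))"
    and "mass u \<noteq> 0 \<Longrightarrow> triangle_map A B C (point d) (point e) (point f) (point u)
           = point ((u$1 / mass d) *\<^sub>R d + (u$2 / mass e) *\<^sub>R e + (u$3 / mass f) *\<^sub>R f)"
    using triangle_map_points[of d' e' f'] by (simp_all add: d'_def e'_def f'_def)
qed

section \<open>The complement map and the two cevian maps\<close>

lemma inv_complement_map:
  "inv (complement_map A B C) = ext_affine (\<lambda>v. - 2 *\<^sub>R v) (A + B + C)" (is "_ = ?J")
proof -
  have dir: "(\<lambda>v. - 2 *\<^sub>R v) ` Rep_direction d = Rep_direction d" for d
  proof -
    have S: "subspace (Rep_direction d)" using Rep_direction[of d] by simp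
    show ?thesis
    proof (intro equalityI subsetI)
      fix v assume "v \<in> Rep_direction d"
      then have "(- 1 / 2) *\<^sub>R v \<in> Rep_direction d" using S by (rule subspace_scale[rotated])
      moreover have "v = - 2 *\<^sub>R ((- 1 / 2) *\<^sub>R v)" by simp
      ultimately show "v \<in> (\<lambda>v. - 2 *\<^sub>R v) ` Rep_direction d" by blast
    qed (use S subspace_scale in blast)
  qed
  have G: "A + B + C = 3 *\<^sub>R centroid A B C" by (simp add: centroid_def)
  show ?thesis
  proof (rule inv_unique_comp)
    show "complement_map A B C \<circ> ?J = id"
    proof
      fix X show "(complement_map A B C \<circ> ?J) X = id X"
      proof (cases X)
        case (Ordinary x)
        then show ?thesis unfolding G by (simp add: vec_eq_iff forall_2 algebra_simps)
      next
        case (Infinite d)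
        then show ?thesis using dir[of d] by (simp add: Rep_direction_inverse)
      qed
    qed
    show "?J \<circ> complement_map A B C = id"
    proof
      fix X show "(?J \<circ> complement_map A B C) X = id X"
      proof (cases X)
        case (Ordinary x)
        then show ?thesis unfolding G by (simp add: vec_eq_iff forall_2 algebra_simps)
      next
        case (Infinite d)
        then show ?thesis using dir[of d] by (simp add: Rep_direction_inverse)
      qed
    qed
  qed
qed

lemma affine_map_inv_complement_map: "affine_map (inv (complement_map A B C))"
proof -
  have "linear (\<lambda>v :: real^2. - 2 *\<^sub>R v)" by (rule linearI) (simp_all add: algebra_simps)
  moreover have "inj (\<lambda>v :: real^2. - 2 *\<^sub>R v)" by (simp add: inj_def)
  ultimately show ?thesis unfolding inv_complement_map affine_map_def by blast
qed

lemma anticomplementary_vertices: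
  "inv (complement_map A B C) (Ordinary A) = bary (- 1) 1 1"
  "inv (complement_map A B C) (Ordinary B) = bary 1 (- 1) 1"
  "inv (complement_map A B C) (Ordinary C) = bary 1 1 (- 1)"
  by (simp_all add: inv_complement_map bary_ordinary vec_eq_iff)

lemma on_anticomplementary_sides_bary:
  assumes "x \<noteq> 0 \<or> y \<noteq> 0 \<or> z \<noteq> 0"
  shows "on_anticomplementary_sides A B C (bary x y z) \<longleftrightarrow> y + z = 0 \<or> x + z = 0 \<or> x + y = 0"
  using assms
  by (simp add: on_anticomplementary_sides_def on_sides_def anticomplementary_vertices
      line_through_points cross_vector vector_eq_0_iff point_in_line_iff bary_def inner_vector) auto

lemma T_map_bary:
  assumes "x \<noteq> 0" "y \<noteq> 0" "z \<noteq> 0" and "y + z \<noteq> 0" "x + z \<noteq> 0" "x + y \<noteq> 0"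
  shows "affine_map (T_map A B C (bary x y z))"
    and "p + q + r \<noteq> 0 \<Longrightarrow> T_map A B C (bary x y z) (bary p q r)
           = bary (q * x / (x + z) + r * x / (x + y)) (p * y / (y + z) + r * y / (x + y))
                  (p * z / (y + z) + q * z / (x + z))"
proof -
  let ?d = "vector [0, y, z] :: real^3" and ?e = "vector [x, 0, z] :: real^3"
    and ?f = "vector [x, y, 0] :: real^3"
  have T: "T_map A B C (bary x y z) = triangle_map A B C (point ?d) (point ?e) (point ?f)"
    using assms by (simp add: T_map_def cevian_traces_bary) (simp add: bary_def)
  have masses: "mass ?d = y + z" "mass ?e = x + z" "mass ?f = x + y"
    by (simp_all add: mass_def vector_3)
  have det: "?d \<bullet> (?e \<times> ?f) \<noteq> 0"
    using assms by (simp add: cross_vector inner_vector)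
  show "affine_map (T_map A B C (bary x y z))"
    unfolding T using assms det masses by (intro triangle_map_weighted) simp_all
  assume "p + q + r \<noteq> 0"
  then have "mass (vector [p, q, r]) \<noteq> 0" by (simp add: mass_def vector_3)
  then have "T_map A B C (bary x y z) (bary p q r) = point ((p / (y + z)) *\<^sub>R ?d + (q / (x + z)) *\<^sub>R ?e + (r / (x + y)) *\<^sub>R ?f)"
    unfolding T using assms triangle_map_weighted(2)[OF _ _ _ det, of "vector [p, q, r]"]
    by (simp add: bary_def masses vector_3)
  also have "(p / (y + z)) *\<^sub>R ?d + (q / (x + z)) *\<^sub>R ?e + (r / (x + y)) *\<^sub>R ?f
      = vector [q * x / (x + z) + r * x / (x + y), p * y / (y + z) + r * y / (x + y),
                  p * z / (y + z) + q * z / (x + z)]"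
    by (simp add: vec_eq_iff forall_3 vector_3)
  finally show "T_map A B C (bary x y z) (bary p q r)
           = bary (q * x / (x + z) + r * x / (x + y)) (p * y / (y + z) + r * y / (x + y))
                  (p * z / (y + z) + q * z / (x + z))"
    by (simp add: bary_def)
qed

lemma T'_map_bary:
  assumes "x \<noteq> 0" "y \<noteq> 0" "z \<noteq> 0" and "y + z \<noteq> 0" "x + z \<noteq> 0" "x + y \<noteq> 0"
  shows "affine_map (T'_map A B C (bary x y z))"
    and "T'_map A B C (bary x y z) (Ordinary A) = bary 0 z y"
    and "T'_map A B C (bary x y z) (Ordinary B) = bary z 0 x"
    and "T'_map A B C (bary x y z) (Ordinary C) = bary y x 0"
proof -
  let ?d = "vector [0, z, y] :: real^3" and ?e = "vector [z, 0, x] :: real^3"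
    and ?f = "vector [y, x, 0] :: real^3"
  have T: "T'_map A B C (bary x y z) = triangle_map A B C (point ?d) (point ?e) (point ?f)"
    using assms by (simp add: T'_map_def isotomic_traces_bary) (simp add: bary_def)
  have masses: "mass ?d \<noteq> 0" "mass ?e \<noteq> 0" "mass ?f \<noteq> 0"
    using assms by (simp_all add: mass_def vector_3 add.commute)
  have det: "?d \<bullet> (?e \<times> ?f) \<noteq> 0"
    using assms by (simp add: cross_vector inner_vector)
  show "affine_map (T'_map A B C (bary x y z))"
    unfolding T using masses det by (rule triangle_map_weighted)
  note image = triangle_map_weighted(2)[OF masses det]
  show "T'_map A B C (bary x y z) (Ordinary A) = bary 0 z y"
    "T'_map A B C (bary x y z) (Ordinary B) = bary z 0 x"
    "T'_map A B C (bary x y z) (Ordinary C) = bary y x 0"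
    using masses unfolding T triangle_vertices
    by (subst image; simp add: mass_def vector_3 point_scale bary_def)+
qed

lemma bary_eq_anticomplementary_vertex:
  assumes "k \<noteq> 0"
  shows "bary (- k) k k = bary (- 1) 1 1" "bary k (- k) k = bary 1 (- 1) 1"
    "bary k k (- k) = bary 1 1 (- 1)"
  using assms by (simp_all add: bary_eq_iff)

lemma weights_of_anticomplementary_vertex:
  assumes "bary p q r = bary (- 1) 1 1" "q \<noteq> 0"
  shows "p + q = 0"
proof -
  have "p * 1 = q * (- 1)"
    using assms bary_eq_iff[of p q r "- 1" 1 1] by (metis zero_neq_one)
  then show ?thesis by simp
qed

end

text \<open>
  The algebraic core. With \<open>(a, b, c)\<close> a permutation of the coordinates of \<open>P\<close>, the left-hand side is
  the sum of two coordinates of the image of a vertex under the composite map, and it must vanish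
  if the image is to be the corresponding vertex of the anticomplementary triangle.
\<close>

lemma cevian_weights_sum:
  fixes a b c :: real
  assumes "a + b \<noteq> 0" "a + c \<noteq> 0"
  shows "(c * a / (a + c) + b * a / (a + b)) + b * b / (a + b) = (a * b + b * c + c * a) / (a + c)"
proof -
  have "b * a / (a + b) + b * b / (a + b) = b"
    using assms by (simp flip: add_divide_distrib distrib_left)
  moreover have "c * a / (a + c) + b = (a * b + b * c + c * a) / (a + c)"
    using assms by (simp add: field_simps)
  ultimately show ?thesis by linarith
qed

theorem theorem3p13:
  fixes A B C :: "real^2" and P :: ext_point
  assumes "\<not> collinear {A, B, C}"
    and "\<not> on_triangle_sides A B C P"
    and "\<not> on_anticomplementary_sides A B C P"
    and "P \<noteq> Ordinary A" and "P \<noteq> Ordinary B" and "P \<noteq> Ordinary C"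
  shows "P \<in> steiner_circumellipse A B C \<longleftrightarrow>
         T_map A B C P \<circ> T'_map A B C P = inv (complement_map A B C)"
proof -
  interpret triangle A B C by unfold_locales (fact assms(1))
  obtain x y z where P: "x \<noteq> 0 \<or> y \<noteq> 0 \<or> z \<noteq> 0" "P = bary x y z" by (rule point_surj_bary)
  have nz: "x \<noteq> 0" "y \<noteq> 0" "z \<noteq> 0"
    using assms(2) P on_triangle_sides_bary by auto
  have sums: "y + z \<noteq> 0" "x + z \<noteq> 0" "x + y \<noteq> 0"
    using assms(3) P on_anticomplementary_sides_bary by auto
  let ?s = "x * y + y * z + z * x" and ?f = "T_map A B C P \<circ> T'_map A B C P"
  have fA: "?f (Ordinary A) = bary (z * x / (x + z) + y * x / (x + y)) (y * y / (x + y)) (z * z / (x + z))"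
    and fB: "?f (Ordinary B) = bary (x * x / (x + y)) (z * y / (y + z) + x * y / (x + y)) (z * z / (y + z))"
    and fC: "?f (Ordinary C) = bary (x * x / (x + z)) (y * y / (y + z)) (y * z / (y + z) + x * z / (x + z))"
    using nz sums P by (simp_all add: T'_map_bary T_map_bary add.commute)
  have wA: "(z * x / (x + z) + y * x / (x + y)) + y * y / (x + y) = ?s / (x + z)"
      "(z * x / (x + z) + y * x / (x + y)) + z * z / (x + z) = ?s / (x + y)"
    using cevian_weights_sum[of x y z] cevian_weights_sum[of x z y] sums by (simp_all add: algebra_simps)
  have wB: "(z * y / (y + z) + x * y / (x + y)) + x * x / (x + y) = ?s / (y + z)"
      "(z * y / (y + z) + x * y / (x + y)) + z * z / (y + z) = ?s / (x + y)"
    using cevian_weights_sum[of y x z] cevian_weights_sum[of y z x] sums by (simp_all add: algebra_simps)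
  have wC: "(y * z / (y + z) + x * z / (x + z)) + x * x / (x + z) = ?s / (y + z)"
      "(y * z / (y + z) + x * z / (x + z)) + y * y / (y + z) = ?s / (x + z)"
    using cevian_weights_sum[of z x y] cevian_weights_sum[of z y x] sums by (simp_all add: algebra_simps)
  have "?f = inv (complement_map A B C) \<longleftrightarrow> ?s = 0"
  proof
    assume "?f = inv (complement_map A B C)"
    then have "bary (z * x / (x + z) + y * x / (x + y)) (y * y / (x + y)) (z * z / (x + z)) = bary (- 1) 1 1"
      using fA anticomplementary_vertices(1) by simp
    then have "(z * x / (x + z) + y * x / (x + y)) + y * y / (x + y) = 0"
      using nz sums by (intro weights_of_anticomplementary_vertex) simp_all
    then show "?s = 0" using wA(1) sums by simp
  next
    assume s: "?s = 0"
    show "?f = inv (complement_map A B C)"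
    proof (rule affine_map_eqI)
      show "affine_map ?f" using nz sums P by (simp add: affine_map_comp T_map_bary T'_map_bary)
      show "affine_map (inv (complement_map A B C))" by (rule affine_map_inv_complement_map)
      have "z * x / (x + z) + y * x / (x + y) = - (y * y / (x + y))" "z * z / (x + z) = y * y / (x + y)"
        using wA s by simp_all
      note weights = this
      have "y * y / (x + y) \<noteq> 0" using nz sums by simp
      then show "?f (Ordinary A) = inv (complement_map A B C) (Ordinary A)"
        unfolding fA weights anticomplementary_vertices by (rule bary_eq_anticomplementary_vertex)
      have "z * y / (y + z) + x * y / (x + y) = - (x * x / (x + y))" "z * z / (y + z) = x * x / (x + y)"
        using wB s by simp_all
      note weights = this
      have "x * x / (x + y) \<noteq> 0" using nz sums by simp
      then show "?f (Ordinary B) = inv (complement_map A B C) (Ordinary B)"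
        unfolding fB weights anticomplementary_vertices by (rule bary_eq_anticomplementary_vertex)
      have "y * z / (y + z) + x * z / (x + z) = - (x * x / (x + z))" "y * y / (y + z) = x * x / (x + z)"
        using wC s by simp_all
      note weights = this
      have "x * x / (x + z) \<noteq> 0" using nz sums by simp
      then show "?f (Ordinary C) = inv (complement_map A B C) (Ordinary C)"
        unfolding fC weights anticomplementary_vertices by (rule bary_eq_anticomplementary_vertex)
    qed
  qed
  then show ?thesis
    using steiner_circumellipse_bary[OF nz] unfolding P(2) by blast
qed

end
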